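(* Let $F$ be a baseline distribution function with density $f$ and $F(0)=0$. For $\alpha\ge 0$, $\beta,\theta>0$, let $G_{\alpha,\beta,\theta}$ be the distribution function whose odds function is $$\Lambda_{G_{\alpha,\beta,\theta}}(x)=\beta\left((\alpha+\Lambda_F(x))^\theta-\alpha^\theta\right),$$ and for $\alpha_1\ge 0$, $\beta_1,\theta_1>0$ let $$K_{\alpha_1,\beta_1,\theta_1}(x)=1-\frac{1}{\left(\frac{x}{\beta_1}+\alpha_1^{\theta_1}\right)^{1/\theta_1}+1-\alpha_1},\qquad x\ge 0.$$ If $F$ has increasing odds rate, $\theta,\theta_1\ge 1$ and $\beta\beta_1\theta\theta_1 f(0)\,\alpha^{\theta-1}\alpha_1^{\theta_1-1}\ge 1$, then $G_{\alpha,\beta,\theta}\leq_{disp}K_{\alpha_1,\beta_1,\theta_1}$. On the other hand, if $F$ has decreasing odds rate, $\theta,\theta_1\le 1$ and $\beta\beta_1\theta\theta_1 f(0)\,\alpha^{\theta-1}\alpha_1^{\theta_1-1}\le 1$, then $K_{\alpha_1,\beta_1,\theta_1}\leq_{disp}G_{\alpha,\beta,\theta}$.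
   Context: The support of $F$ is an interval contained in $[0,\infty)$ with left endpoint $0$ (so $F(0)=0$ and $F(x)>0$ for $x>0$), and $f(0)$ denotes $\lim_{x\to0^+}f(x)$. The odds function of a distribution function $H$ is $\Lambda_H=H/(1-H)=\frac1{1-H}-1$ (equal to $+\infty$ where $H=1$), and its odds rate is $\lambda_H=\Lambda_H'$, i.e. density divided by $(1-H)^2$. $F$ has increasing (decreasing) odds rate if $\lambda_F$ is weakly increasing (decreasing) on the support of $F$. $F_1\leq_{disp}F_2$ (dispersive order) means that $F_2^{-1}(F_1(x))-x$ is weakly increasing in $x$ on the support of $F_1$. A power $0^\gamma$ is read as $+\infty$ when $\gamma<0$, and $0^0=1$. *)

theory Defs
  imports "HOL-Probability.Probability"
begin

definition distribution_function :: "(real \<Rightarrow> real) \<Rightarrow> bool" where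
  "distribution_function H \<longleftrightarrow> (\<exists>M. real_distribution M \<and> H = cdf M)"

(* Densities take values in ennreal, so that h 0 can be a limit equal to infinity. *)
definition has_density :: "(real \<Rightarrow> real) \<Rightarrow> (real \<Rightarrow> ennreal) \<Rightarrow> bool" where
  "has_density H h \<longleftrightarrow>
     h \<in> borel_measurable borel \<and>
     real_distribution (density lborel h) \<and> H = cdf (density lborel h)"

(* Topological support of the distribution; closed, hence it contains its finite endpoints. *)
definition supp :: "(real \<Rightarrow> real) \<Rightarrow> real set" where
  "supp H = {x. \<forall>\<epsilon>>0. H (x - \<epsilon>) < H (x + \<epsilon>)}"

(* Restricting the infimum to the support changes nothing for 0 < p \<le> 1; for p = 0 it gives
   the left endpoint of the support instead of -\<infinity>. The value is \<infinity> if p is not attained. *)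
definition quantile :: "(real \<Rightarrow> real) \<Rightarrow> real \<Rightarrow> ereal" where
  "quantile H p = Inf (ereal ` {x \<in> supp H. p \<le> H x})"

definition disp_le :: "(real \<Rightarrow> real) \<Rightarrow> (real \<Rightarrow> real) \<Rightarrow> bool"
    (infix \<open>\<le>\<^sub>d\<^sub>i\<^sub>s\<^sub>p\<close> 50) where
  "H\<^sub>1 \<le>\<^sub>d\<^sub>i\<^sub>s\<^sub>p H\<^sub>2 \<longleftrightarrow> mono_on (supp H\<^sub>1) (\<lambda>x. quantile H\<^sub>2 (H\<^sub>1 x) - ereal x)"

definition odds :: "(real \<Rightarrow> real) \<Rightarrow> real \<Rightarrow> ennreal" where
  "odds H x = (if H x = 1 then \<top> else ennreal (H x / (1 - H x)))"

(* The value \<top> where H = 1 makes the rate at a finite right endpoint of the support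
   independent of the value the chosen version of the density takes there. *)
definition odds_rate :: "(real \<Rightarrow> real) \<Rightarrow> (real \<Rightarrow> ennreal) \<Rightarrow> real \<Rightarrow> ennreal" where
  "odds_rate H h x = (if H x = 1 then \<top> else h x / ennreal ((1 - H x)\<^sup>2))"

definition increasing_odds_rate :: "(real \<Rightarrow> real) \<Rightarrow> (real \<Rightarrow> ennreal) \<Rightarrow> bool" where
  "increasing_odds_rate H h \<longleftrightarrow> mono_on (supp H) (odds_rate H h)"

definition decreasing_odds_rate :: "(real \<Rightarrow> real) \<Rightarrow> (real \<Rightarrow> ennreal) \<Rightarrow> bool" where
  "decreasing_odds_rate H h \<longleftrightarrow> antimono_on (supp H) (odds_rate H h)"

(* Real powers on [0,\<infinity>]. Unlike powr on the reals (where 0 powr a = 0 for all a), a zero base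
   gives 1 for exponent 0 and \<infinity> for negative exponents. *)
definition epowr :: "ennreal \<Rightarrow> real \<Rightarrow> ennreal" where
  "epowr x a =
     (if a = 0 then 1
      else if x = 0 then (if a < 0 then \<top> else 0)
      else if x = \<top> then (if a < 0 then 0 else \<top>)
      else ennreal (enn2real x powr a))"

definition K_dist :: "real \<Rightarrow> real \<Rightarrow> real \<Rightarrow> real \<Rightarrow> real" where
  "K_dist \<alpha> \<beta> \<theta> x =
     (if x < 0 then 0
      else 1 - 1 / ((x / \<beta> + \<alpha> powr \<theta>) powr (1 / \<theta>) + 1 - \<alpha>))"

end

theory Submission
  imports Defs
begin

text \<open>
  The odds function of \<open>F\<close> need not be differentiable, so the chain rule is replaced by difference
  estimates. With \<open>L = F / (1 - F)\<close>, monotonicity of the odds rate bounds \<open>L y - L x\<close> by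
  \<open>f 0 * (y - x)\<close> from one side. The function \<open>h\<close>, formally the composition of the inverse of \<open>K\<close>
  with \<open>G\<close>, is obtained from \<open>L\<close> by two maps \<open>l \<mapsto> b * ((a + l) powr s - a powr s)\<close>, whose
  difference quotients are at least (\<open>s \<ge> 1\<close>) or at most (\<open>s \<le> 1\<close>) \<open>b * s * a powr (s - 1)\<close>.
  Hence \<open>h y - h x\<close> is at least (at most) \<open>y - x\<close>, which is the dispersive order.
\<close>

section \<open>Increments of the odds from increments of the distribution function\<close>

lemma odds_diff:
  fixes p q :: real
  assumes "p < 1" "q < 1"
  shows "q / (1 - q) - p / (1 - p) = (q - p) / ((1 - p) * (1 - q))"
  using assms by (simp add: divide_simps) (simp add: algebra_simps)

lemma odds_le_iff:
  fixes p q :: real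
  assumes "p < 1" "q < 1"
  shows "p / (1 - p) \<le> q / (1 - q) \<longleftrightarrow> p \<le> q"
  using assms by (simp add: divide_simps) (simp add: algebra_simps)

text \<open>
  An increment of the odds is \<open>(F b - F a) / ((1 - F a) * (1 - F b))\<close>, so the hypothesis gives the
  bound up to the factor \<open>(1 - F b) / (1 - F a)\<close>; this is near 1 locally by continuity, and the
  local bounds with a slightly worse constant add up.
\<close>

lemma odds_lower_growth:
  fixes F :: "real \<Rightarrow> real"
  assumes "x \<le> y" "0 \<le> c"
    and cont: "\<And>t. x \<le> t \<Longrightarrow> t \<le> y \<Longrightarrow> isCont F t"
    and less1: "\<And>t. x \<le> t \<Longrightarrow> t \<le> y \<Longrightarrow> F t < 1"
    and growth: "\<And>a b. x \<le> a \<Longrightarrow> a \<le> b \<Longrightarrow> b \<le> y \<Longrightarrow> c * (1 - F b)\<^sup>2 * (b - a) \<le> F b - F a"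
  shows "c * (y - x) \<le> F y / (1 - F y) - F x / (1 - F x)"
proof -
  \<comment> \<open>The gap between \<open>d\<close> and \<open>c\<close> absorbs the factor
    \<open>(1 - F b) / (1 - F a)\<close> on short intervals; letting \<open>d\<close> tend to
    \<open>c\<close> closes the proof.\<close>
  have step: "d * (y - x) \<le> F y / (1 - F y) - F x / (1 - F x)" if "0 \<le> d" "d < c" for d
  proof -
    let ?P = "\<lambda>a b. x \<le> a \<longrightarrow> b \<le> y \<longrightarrow> d * (b - a) \<le> F b / (1 - F b) - F a / (1 - F a)"
    have "?P x y"
    \<comment> \<open>Bisection: a property that passes from adjacent intervals to their union, and
      holds for all short intervals around each point, holds for the whole interval. The premises
      inside \<open>?P\<close> keep the short intervals within \<open>[x, y]\<close>.\<close>
    proof (rule Bolzano[where P = ?P])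
      show "x \<le> y" by fact
    next
      fix p q r
      assume "?P p q" "?P q r" "p \<le> q" "q \<le> r"
      then show "?P p r" by (auto simp: algebra_simps)
    next
      fix t assume t: "x \<le> t" "t \<le> y"
      \<comment> \<open>This \<open>e\<close> solves
        \<open>d * ((1 - F t) + e) = c * ((1 - F t) - e)\<close>, so an oscillation of
        \<open>F\<close> below \<open>e\<close> around \<open>t\<close> yields
        \<open>d * (1 - F a) \<le> c * (1 - F b)\<close>.\<close>
      define e where "e = (c - d) * (1 - F t) / (c + d)"
      have cd: "c + d > 0" using that by simp
      have "e > 0" using cd that less1[OF t] by (simp add: e_def)
      then obtain s where s: "s > 0" "\<And>z. \<bar>z - t\<bar> < s \<Longrightarrow> \<bar>F z - F t\<bar> < e"
        using cont[OF t] by (auto simp: continuous_at_eps_delta dist_real_def)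
      show "\<exists>s>0. \<forall>a b. a \<le> t \<and> t \<le> b \<and> b - a < s \<longrightarrow> ?P a b"
      proof (intro exI[of _ s] conjI allI impI s(1))
        fix a b assume ab: "a \<le> t \<and> t \<le> b \<and> b - a < s" and bd: "x \<le> a" "b \<le> y"
        have F1: "F a < 1" "F b < 1" using ab bd t by (auto intro!: less1)
        have Fa: "1 - F a \<le> (1 - F t) + e" and Fb: "(1 - F t) - e \<le> 1 - F b"
          using s(2)[of a] s(2)[of b] ab by auto
        have "d * (1 - F a) \<le> d * ((1 - F t) + e)"
          using Fa that(1) by (intro mult_left_mono) auto
        also have "\<dots> = c * ((1 - F t) - e)"
          using cd by (simp add: e_def field_simps)
        also have "\<dots> \<le> c * (1 - F b)"
          using Fb \<open>0 \<le> c\<close> by (intro mult_left_mono) auto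
        finally have le: "d * (1 - F a) \<le> c * (1 - F b)" .
        have "d * (b - a) * ((1 - F a) * (1 - F b)) = (d * (1 - F a)) * ((1 - F b) * (b - a))"
          by simp
        also have "\<dots> \<le> (c * (1 - F b)) * ((1 - F b) * (b - a))"
          using le ab F1 by (intro mult_right_mono) auto
        also have "\<dots> = c * (1 - F b)\<^sup>2 * (b - a)"
          by (simp add: power2_eq_square)
        also have "\<dots> \<le> F b - F a"
          using growth[of a b] ab bd by auto
        finally show "d * (b - a) \<le> F b / (1 - F b) - F a / (1 - F a)"
          using F1 by (simp add: odds_diff pos_le_divide_eq)
      qed
    qed
    then show ?thesis by simp
  qed
  \<comment> \<open>Settles \<open>c = 0\<close>, where no \<open>d\<close> with
    \<open>0 \<le> d < c\<close> exists.\<close>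
  have "0 \<le> F y / (1 - F y) - F x / (1 - F x)"
    using growth[of x y] \<open>x \<le> y\<close> \<open>0 \<le> c\<close> less1[of x] less1[of y]
    by (smt (verit) odds_le_iff mult_nonneg_nonneg zero_le_power2)
  moreover have "c \<le> (F y / (1 - F y) - F x / (1 - F x)) / (y - x)" if "x < y" "0 < c"
  proof (rule dense_le_bounded[of 0])
    fix d assume "0 < d" "d < c"
    then show "d \<le> (F y / (1 - F y) - F x / (1 - F x)) / (y - x)"
      using step[of d] that by (simp add: pos_le_divide_eq)
  qed (use that in simp)
  ultimately show ?thesis
    using \<open>x \<le> y\<close> \<open>0 \<le> c\<close> by (cases "x = y"; cases "c = 0") (auto simp: pos_le_divide_eq)
qed

text \<open>The argument of \<open>odds_lower_growth\<close> with the inequalities reversed: the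
  factor to absorb is \<open>(1 - F a) / (1 - F b)\<close>, and the slack comes from
  \<open>d > c\<close>.\<close>

lemma odds_upper_growth:
  fixes F :: "real \<Rightarrow> real"
  assumes "x \<le> y" "0 \<le> c"
    and cont: "\<And>t. x \<le> t \<Longrightarrow> t \<le> y \<Longrightarrow> isCont F t"
    and less1: "\<And>t. x \<le> t \<Longrightarrow> t \<le> y \<Longrightarrow> F t < 1"
    and growth: "\<And>a b. x \<le> a \<Longrightarrow> a \<le> b \<Longrightarrow> b \<le> y \<Longrightarrow> F b - F a \<le> c * (1 - F a)\<^sup>2 * (b - a)"
  shows "F y / (1 - F y) - F x / (1 - F x) \<le> c * (y - x)"
proof -
  have step: "F y / (1 - F y) - F x / (1 - F x) \<le> d * (y - x)" if "c < d" for d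
  proof -
    let ?P = "\<lambda>a b. x \<le> a \<longrightarrow> b \<le> y \<longrightarrow> F b / (1 - F b) - F a / (1 - F a) \<le> d * (b - a)"
    have "?P x y"
    proof (rule Bolzano[where P = ?P])
      show "x \<le> y" by fact
    next
      fix p q r
      assume "?P p q" "?P q r" "p \<le> q" "q \<le> r"
      then show "?P p r" by (auto simp: algebra_simps)
    next
      fix t assume t: "x \<le> t" "t \<le> y"
      define e where "e = (d - c) * (1 - F t) / (c + d)"
      have cd: "c + d > 0" using that \<open>0 \<le> c\<close> by simp
      have "e > 0" using cd that less1[OF t] by (simp add: e_def)
      then obtain s where s: "s > 0" "\<And>z. \<bar>z - t\<bar> < s \<Longrightarrow> \<bar>F z - F t\<bar> < e"
        using cont[OF t] by (auto simp: continuous_at_eps_delta dist_real_def)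
      show "\<exists>s>0. \<forall>a b. a \<le> t \<and> t \<le> b \<and> b - a < s \<longrightarrow> ?P a b"
      proof (intro exI[of _ s] conjI allI impI s(1))
        fix a b assume ab: "a \<le> t \<and> t \<le> b \<and> b - a < s" and bd: "x \<le> a" "b \<le> y"
        have F1: "F a < 1" "F b < 1" using ab bd t by (auto intro!: less1)
        have Fa: "1 - F a \<le> (1 - F t) + e" and Fb: "(1 - F t) - e \<le> 1 - F b"
          using s(2)[of a] s(2)[of b] ab by auto
        have "c * (1 - F a) \<le> c * ((1 - F t) + e)"
          using Fa \<open>0 \<le> c\<close> by (intro mult_left_mono) auto
        also have "\<dots> = d * ((1 - F t) - e)"
          using cd by (simp add: e_def field_simps)
        also have "\<dots> \<le> d * (1 - F b)"
          using Fb that \<open>0 \<le> c\<close> by (intro mult_left_mono) auto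
        finally have le: "c * (1 - F a) \<le> d * (1 - F b)" .
        have "F b - F a \<le> c * (1 - F a)\<^sup>2 * (b - a)"
          using growth[of a b] ab bd by auto
        also have "\<dots> = (c * (1 - F a)) * ((1 - F a) * (b - a))"
          by (simp add: power2_eq_square)
        also have "\<dots> \<le> (d * (1 - F b)) * ((1 - F a) * (b - a))"
          using le ab F1 by (intro mult_right_mono) auto
        also have "\<dots> = d * (b - a) * ((1 - F a) * (1 - F b))"
          by simp
        finally show "F b / (1 - F b) - F a / (1 - F a) \<le> d * (b - a)"
          using F1 by (simp add: odds_diff pos_divide_le_eq)
      qed
    qed
    then show ?thesis by simp
  qed
  have "(F y / (1 - F y) - F x / (1 - F x)) / (y - x) \<le> c" if "x < y"
  proof (rule dense_ge)
    fix d assume "c < d"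
    then show "(F y / (1 - F y) - F x / (1 - F x)) / (y - x) \<le> d"
      using step[of d] that by (simp add: pos_divide_le_eq)
  qed
  then show ?thesis
    using \<open>x \<le> y\<close> by (cases "x = y") (auto simp: pos_divide_le_eq)
qed

section \<open>Difference quotients of powers\<close>

lemma epowr_ennreal:
  assumes "0 \<le> a" "0 < s \<or> 0 < a"
  shows "epowr (ennreal a) s = ennreal (a powr s)"
  using assms by (auto simp: epowr_def)

text \<open>By the mean value theorem the quotient is \<open>s * z powr (s - 1)\<close> for some
  \<open>z > a\<close>, and this power is increasing in its base. For \<open>a = 0\<close> the
  constant is 0 if \<open>s > 1\<close>, and \<open>0^0 = 1\<close> gives equality if
  \<open>s = 1\<close>.\<close>

lemma powr_diff_lower:
  fixes a u v s :: real
  assumes "1 \<le> s" "0 \<le> a" "a \<le> u" "u \<le> v"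
  shows "ennreal s * epowr (ennreal a) (s - 1) * ennreal (v - u) \<le> ennreal (v powr s - u powr s)"
proof (cases "s = 1 \<or> a = 0 \<or> u = v")
  case True
  then show ?thesis
    using assms by (auto simp: epowr_def)
next
  case False
  then have a: "0 < a" "u < v" using assms by auto
  have "\<exists>z>u. z < v \<and> v powr s - u powr s = (v - u) * (s * z powr (s - 1))"
    using a assms by (intro MVT2) (auto intro!: derivative_eq_intros)
  then obtain z where z: "u < z" "v powr s - u powr s = (v - u) * (s * z powr (s - 1))"
    by blast
  have "a powr (s - 1) \<le> z powr (s - 1)"
    using z assms by (intro powr_mono2) auto
  then have "s * a powr (s - 1) * (v - u) \<le> v powr s - u powr s"
    using a assms by (simp add: z(2) mult.commute)
  then show ?thesis
    using a assms by (simp add: epowr_ennreal ennreal_mult'[symmetric] ennreal_leI)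
qed

text \<open>As before, but for \<open>s \<le> 1\<close> the derivative is decreasing. For
  \<open>a = 0\<close> and \<open>s < 1\<close> the constant is infinite, so only
  \<open>u = v\<close> needs an argument, and there the left side is 0.\<close>

lemma powr_diff_upper:
  fixes a u v s :: real
  assumes "0 < s" "s \<le> 1" "0 \<le> a" "a \<le> u" "u \<le> v"
  shows "ennreal (v powr s - u powr s) \<le> ennreal s * epowr (ennreal a) (s - 1) * ennreal (v - u)"
proof (cases "s = 1 \<or> a = 0 \<or> u = v")
  case True
  then show ?thesis
    using assms by (auto simp: epowr_def ennreal_mult_top ennreal_top_mult)
next
  case False
  then have a: "0 < a" "u < v" using assms by auto
  have "\<exists>z>u. z < v \<and> v powr s - u powr s = (v - u) * (s * z powr (s - 1))"
    using a assms by (intro MVT2) (auto intro!: derivative_eq_intros)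
  then obtain z where z: "u < z" "v powr s - u powr s = (v - u) * (s * z powr (s - 1))"
    by blast
  have "z powr (s - 1) \<le> a powr (s - 1)"
    using z a assms by (intro powr_mono2') auto
  then have "v powr s - u powr s \<le> s * a powr (s - 1) * (v - u)"
    using a assms by (simp add: z(2) mult.commute)
  then show ?thesis
    using a assms by (simp add: epowr_ennreal ennreal_mult'[symmetric] ennreal_leI)
qed

section \<open>From bounds on the odds rate to bounds on increments of the odds\<close>

lemma has_density_isCont:
  assumes "has_density F f"
  shows "isCont F x"
proof -
  have f: "f \<in> borel_measurable borel" and M: "real_distribution (density lborel f)"
    and F: "F = cdf (density lborel f)"
    using assms by (auto simp: has_density_def)
  interpret real_distribution "density lborel f" by fact
  have "emeasure (density lborel f) {x} = 0"
    using f by (simp add: emeasure_density nn_integral_null_set)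
  then show ?thesis
    by (simp add: F isCont_cdf measure_def)
qed

lemma has_density_diff:
  assumes "has_density F f" "x \<le> y"
  shows "ennreal (F y - F x) = (\<integral>\<^sup>+t\<in>{x<..y}. f t \<partial>lborel)"
proof -
  have f: "f \<in> borel_measurable borel" and M: "real_distribution (density lborel f)"
    and F: "F = cdf (density lborel f)"
    using assms by (auto simp: has_density_def)
  interpret real_distribution "density lborel f" by fact
  have "F y - F x = measure (density lborel f) {x<..y}"
    using cdf_diff_eq[of x y] assms(2) by (cases "x = y") (auto simp: F)
  then have "ennreal (F y - F x) = emeasure (density lborel f) {x<..y}"
    by (simp add: emeasure_eq_measure)
  then show ?thesis
    using f by (simp add: emeasure_density)
qed

lemma has_density_bounds:
  assumes "has_density F f"
  shows "mono F" "0 \<le> F x" "F x \<le> 1"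
proof -
  have M: "real_distribution (density lborel f)" and F: "F = cdf (density lborel f)"
    using assms by (auto simp: has_density_def)
  interpret real_distribution "density lborel f" by fact
  show "mono F" "0 \<le> F x" "F x \<le> 1"
    by (auto simp: F mono_def cdf_nondecreasing cdf_nonneg cdf_bounded_prob)
qed

text \<open>On \<open>{a<..b}\<close> the rate bound gives
  \<open>f t \<ge> c * (1 - F t)\<^sup>2 \<ge> c * (1 - F b)\<^sup>2\<close> for every real
  \<open>c \<le> l\<close>; integrating yields the hypothesis of \<open>odds_lower_growth\<close>.
  Approximating \<open>l\<close> from below by reals also covers \<open>l = \<top>\<close>.\<close>

lemma has_density_odds_lower:
  assumes F: "has_density F f" and xy: "x \<le> y" "F y < 1"
    and rate: "\<And>t. x < t \<Longrightarrow> t \<le> y \<Longrightarrow> l \<le> odds_rate F f t"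
  shows "l * ennreal (y - x) \<le> ennreal (F y / (1 - F y) - F x / (1 - F x))"
proof -
  note bounds = has_density_bounds[OF F]
  have less1: "F t < 1" if "t \<le> y" for t
    using monoD[OF bounds(1) that] xy by simp
  have step: "c * (y - x) \<le> F y / (1 - F y) - F x / (1 - F x)"
    if c: "0 \<le> c" "ennreal c \<le> l" for c
  proof (rule odds_lower_growth[OF xy(1) c(1) has_density_isCont[OF F] less1])
    fix a b assume ab: "x \<le> a" "a \<le> b" "b \<le> y"
    have "ennreal (c * (1 - F b)\<^sup>2 * (b - a)) = (\<integral>\<^sup>+t\<in>{a<..b}. ennreal (c * (1 - F b)\<^sup>2) \<partial>lborel)"
      using ab c by (simp add: nn_integral_cmult_indicator ennreal_mult)
    also have "\<dots> \<le> (\<integral>\<^sup>+t\<in>{a<..b}. f t \<partial>lborel)"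
    proof (rule nn_integral_mono)
      fix t
      show "ennreal (c * (1 - F b)\<^sup>2) * indicator {a<..b} t \<le> f t * indicator {a<..b} t"
      proof (cases "t \<in> {a<..b}")
        case True
        then have Ft: "F t < 1" "F t \<le> F b"
          using ab less1[of t] monoD[OF bounds(1), of t b] by auto
        have "ennreal c \<le> f t / ennreal ((1 - F t)\<^sup>2)"
          using rate[of t] True ab Ft c by (simp add: odds_rate_def)
        then have "ennreal c * ennreal ((1 - F t)\<^sup>2) \<le> f t"
          using mult_right_mono[of "ennreal c" "f t / ennreal ((1 - F t)\<^sup>2)" "ennreal ((1 - F t)\<^sup>2)"] Ft
          by (simp add: ennreal_divide_times)
        moreover have "c * (1 - F b)\<^sup>2 \<le> c * (1 - F t)\<^sup>2"
          using Ft c less1[of b] ab by (intro mult_left_mono power_mono) auto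
        ultimately show ?thesis
          using True c by (simp add: ennreal_mult'[symmetric])
            (meson ennreal_leI order_trans)
      qed simp
    qed
    also have "\<dots> = ennreal (F b - F a)"
      using has_density_diff[OF F ab(2)] by simp
    finally show "c * (1 - F b)\<^sup>2 * (b - a) \<le> F b - F a"
      using monoD[OF bounds(1) ab(2)] by (simp add: ennreal_le_iff)
  qed
  show ?thesis
  proof (cases "x = y")
    case False
    then have "x < y" using xy by simp
    have "l \<le> ennreal ((F y / (1 - F y) - F x / (1 - F x)) / (y - x))"
    proof (rule dense_le)
      fix d assume "d < l"
      then obtain c where c: "d = ennreal c" "0 \<le> c"
        by (cases d) auto
      then show "d \<le> ennreal ((F y / (1 - F y) - F x / (1 - F x)) / (y - x))"
        using step[of c] \<open>d < l\<close> \<open>x < y\<close> by (simp add: ennreal_leI pos_le_divide_eq)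
    qed
    then have "l * ennreal (y - x)
        \<le> ennreal ((F y / (1 - F y) - F x / (1 - F x)) / (y - x)) * ennreal (y - x)"
      by (rule mult_right_mono) simp
    also have "\<dots> = ennreal (F y / (1 - F y) - F x / (1 - F x))"
      using \<open>x < y\<close> by (simp add: ennreal_mult''[symmetric])
    finally show ?thesis .
  qed simp
qed

text \<open>Here \<open>f t \<le> c * (1 - F t)\<^sup>2 \<le> c * (1 - F a)\<^sup>2\<close> is
  integrated. An infinite \<open>l\<close> makes the right side infinite unless
  \<open>x = y\<close>.\<close>

lemma has_density_odds_upper:
  assumes F: "has_density F f" and xy: "x \<le> y" "F y < 1"
    and rate: "\<And>t. x < t \<Longrightarrow> t \<le> y \<Longrightarrow> odds_rate F f t \<le> l"
  shows "ennreal (F y / (1 - F y) - F x / (1 - F x)) \<le> l * ennreal (y - x)"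
proof (cases l)
  case (real c)
  note bounds = has_density_bounds[OF F]
  have less1: "F t < 1" if "t \<le> y" for t
    using monoD[OF bounds(1) that] xy by simp
  have "F y / (1 - F y) - F x / (1 - F x) \<le> c * (y - x)"
  proof (rule odds_upper_growth[OF xy(1) real(1) has_density_isCont[OF F] less1])
    fix a b assume ab: "x \<le> a" "a \<le> b" "b \<le> y"
    have "ennreal (F b - F a) = (\<integral>\<^sup>+t\<in>{a<..b}. f t \<partial>lborel)"
      using has_density_diff[OF F ab(2)] by simp
    also have "\<dots> \<le> (\<integral>\<^sup>+t\<in>{a<..b}. ennreal (c * (1 - F a)\<^sup>2) \<partial>lborel)"
    proof (rule nn_integral_mono)
      fix t
      show "f t * indicator {a<..b} t \<le> ennreal (c * (1 - F a)\<^sup>2) * indicator {a<..b} t"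
      proof (cases "t \<in> {a<..b}")
        case True
        then have Ft: "F t < 1" "F a \<le> F t"
          using ab less1[of t] monoD[OF bounds(1), of a t] by auto
        have "f t / ennreal ((1 - F t)\<^sup>2) \<le> ennreal c"
          using rate[of t] True ab Ft real by (simp add: odds_rate_def)
        then have "f t \<le> ennreal c * ennreal ((1 - F t)\<^sup>2)"
          using mult_right_mono[of "f t / ennreal ((1 - F t)\<^sup>2)" "ennreal c" "ennreal ((1 - F t)\<^sup>2)"] Ft
          by (simp add: ennreal_divide_times)
        moreover have "c * (1 - F t)\<^sup>2 \<le> c * (1 - F a)\<^sup>2"
          using Ft real by (intro mult_left_mono power_mono) auto
        ultimately show ?thesis
          using True real by (simp add: ennreal_mult'[symmetric])
            (meson ennreal_leI order_trans)
      qed simp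
    qed
    also have "\<dots> = ennreal (c * (1 - F a)\<^sup>2 * (b - a))"
      using ab real by (simp add: nn_integral_cmult_indicator ennreal_mult)
    finally show "F b - F a \<le> c * (1 - F a)\<^sup>2 * (b - a)"
      using ab real by (simp add: ennreal_le_iff)
  qed
  then show ?thesis
    using real xy by (simp add: ennreal_mult'[symmetric] ennreal_leI)
next
  case top
  then show ?thesis
    using xy by (cases "x = y") (auto simp: ennreal_top_mult)
qed

section \<open>The power transform of the odds\<close>

text \<open>Serves twice: with the parameters of \<open>G\<close> it turns the odds of
  \<open>F\<close> into those of \<open>G\<close>; with the parameters of \<open>K_dist\<close> it
  inverts the odds function of \<open>K_dist\<close>.\<close>

definition power_odds :: "real \<Rightarrow> real \<Rightarrow> real \<Rightarrow> real \<Rightarrow> real" where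
  "power_odds a b s l = b * ((a + l) powr s - a powr s)"

lemma power_odds_mono:
  assumes "0 \<le> a" "0 < b" "0 < s" "0 \<le> l" "l \<le> m"
  shows "power_odds a b s l \<le> power_odds a b s m"
  using assms by (auto simp: power_odds_def intro!: powr_mono2)

lemma power_odds_le_iff:
  assumes "0 \<le> a" "0 < b" "0 < s" "0 \<le> l" "0 \<le> m"
  shows "power_odds a b s l \<le> power_odds a b s m \<longleftrightarrow> l \<le> m"
  using assms powr_less_mono2[of s "a + m" "a + l"] power_odds_mono[of a b s l m]
  by (cases "l \<le> m") (auto simp: power_odds_def)

lemma power_odds_zero [simp]: "power_odds a b s 0 = 0"
  by (simp add: power_odds_def)

lemma power_odds_nonneg:
  assumes "0 \<le> a" "0 < b" "0 < s" "0 \<le> l"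
  shows "0 \<le> power_odds a b s l"
  using power_odds_mono[of a b s 0 l] assms by simp

lemma power_odds_diff:
  assumes "0 < b"
  shows "ennreal (power_odds a b s m - power_odds a b s l) =
    ennreal b * ennreal ((a + m) powr s - (a + l) powr s)"
  using assms by (simp add: power_odds_def ennreal_mult'[symmetric] right_diff_distrib)

lemma power_odds_diff_lower:
  assumes "1 \<le> s" "0 \<le> a" "0 < b" "0 \<le> l" "l \<le> m"
  shows "ennreal (b * s) * epowr (ennreal a) (s - 1) * ennreal (m - l)
    \<le> ennreal (power_odds a b s m - power_odds a b s l)"
  using mult_left_mono[OF powr_diff_lower[of s a "a + l" "a + m"], of "ennreal b"] assms
  by (simp add: power_odds_diff ennreal_mult mult.assoc)

lemma power_odds_diff_upper:
  assumes "0 < s" "s \<le> 1" "0 \<le> a" "0 < b" "0 \<le> l" "l \<le> m"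
  shows "ennreal (power_odds a b s m - power_odds a b s l)
    \<le> ennreal (b * s) * epowr (ennreal a) (s - 1) * ennreal (m - l)"
  using mult_left_mono[OF powr_diff_upper[of s a "a + l" "a + m"], of "ennreal b"] assms
  by (simp add: power_odds_diff ennreal_mult mult.assoc)

section \<open>Support and quantiles of \<open>K_dist\<close>\<close>

text \<open>Keeps the denominator in \<open>K_dist\<close> at least 1.\<close>

lemma le_root_shift:
  fixes a b s x :: real
  assumes "0 \<le> a" "0 < b" "0 < s" "0 \<le> x"
  shows "a \<le> (x / b + a powr s) powr (1 / s)"
proof -
  have "a = (a powr s) powr (1 / s)"
    using assms by (simp add: powr_powr)
  also have "\<dots> \<le> (x / b + a powr s) powr (1 / s)"
    using assms by (intro powr_mono2) auto
  finally show ?thesis .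
qed

lemma K_dist_less_1:
  assumes "0 \<le> \<alpha>" "0 < \<beta>" "0 < \<theta>"
  shows "K_dist \<alpha> \<beta> \<theta> x < 1"
  using le_root_shift[OF assms, of x] by (cases "x < 0") (auto simp: K_dist_def)

lemma K_dist_strict_mono:
  assumes "0 \<le> \<alpha>" "0 < \<beta>" "0 < \<theta>" "0 \<le> x" "x < y"
  shows "K_dist \<alpha> \<beta> \<theta> x < K_dist \<alpha> \<beta> \<theta> y"
proof -
  have "(x / \<beta> + \<alpha> powr \<theta>) powr (1 / \<theta>) < (y / \<beta> + \<alpha> powr \<theta>) powr (1 / \<theta>)"
    using assms by (intro powr_less_mono2) (auto simp: divide_strict_right_mono)
  then show ?thesis
    using assms le_root_shift[OF assms(1-4)]
    by (auto simp: K_dist_def intro!: divide_strict_left_mono)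
qed

text \<open>The root in \<open>K_dist\<close> undoes the power and leaves
  \<open>1 - 1 / (1 + l)\<close>, which recovers \<open>p\<close> from its odds
  \<open>l\<close>.\<close>

lemma K_dist_power_odds:
  assumes "0 \<le> \<alpha>" "0 < \<beta>" "0 < \<theta>" "0 \<le> p" "p < 1"
  shows "K_dist \<alpha> \<beta> \<theta> (power_odds \<alpha> \<beta> \<theta> (p / (1 - p))) = p"
proof -
  let ?l = "p / (1 - p)"
  have l: "0 \<le> ?l" using assms by simp
  have "power_odds \<alpha> \<beta> \<theta> ?l / \<beta> + \<alpha> powr \<theta> = (\<alpha> + ?l) powr \<theta>"
    using assms by (simp add: power_odds_def)
  then have "(power_odds \<alpha> \<beta> \<theta> ?l / \<beta> + \<alpha> powr \<theta>) powr (1 / \<theta>) = \<alpha> + ?l"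
    using assms l by (simp add: powr_powr)
  then have "K_dist \<alpha> \<beta> \<theta> (power_odds \<alpha> \<beta> \<theta> ?l) = 1 - 1 / (1 + ?l)"
    using power_odds_nonneg[OF assms(1-3) l] by (simp add: K_dist_def add.commute)
  also have "\<dots> = p"
    using assms by (simp add: field_simps)
  finally show ?thesis .
qed

lemma K_dist_le_iff:
  assumes "0 \<le> \<alpha>" "0 < \<beta>" "0 < \<theta>" "0 \<le> x" "0 \<le> y"
  shows "K_dist \<alpha> \<beta> \<theta> x \<le> K_dist \<alpha> \<beta> \<theta> y \<longleftrightarrow> x \<le> y"
  using K_dist_strict_mono[OF assms(1-4), of y] K_dist_strict_mono[OF assms(1-3,5), of x]
  by (cases x y rule: linorder_cases) auto

lemma supp_K_dist:
  assumes "0 \<le> \<alpha>" "0 < \<beta>" "0 < \<theta>"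
  shows "supp (K_dist \<alpha> \<beta> \<theta>) = {0..}"
proof (intro equalityI subsetI)
  fix x assume x: "x \<in> supp (K_dist \<alpha> \<beta> \<theta>)"
  show "x \<in> {0..}"
  proof (rule ccontr)
    assume "x \<notin> {0..}"
    then have neg: "x < 0" "0 < - x / 2" by auto
    then have "K_dist \<alpha> \<beta> \<theta> (x - - x / 2) < K_dist \<alpha> \<beta> \<theta> (x + - x / 2)"
      using x unfolding supp_def by blast
    moreover have "x - - x / 2 < 0" "x + - x / 2 < 0" using neg by auto
    ultimately show False by (simp only: K_dist_def if_True)
  qed
next
  fix x :: real assume x: "x \<in> {0..}"
  have "K_dist \<alpha> \<beta> \<theta> (x - e) < K_dist \<alpha> \<beta> \<theta> (x + e)" if "0 < e" for e
  proof (cases "0 \<le> x - e")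
    case True
    then show ?thesis using that assms by (intro K_dist_strict_mono) auto
  next
    case False
    \<comment> \<open>No jump at 0: the root there equals \<open>\<alpha>\<close>, so the
      denominator is 1 and the value is 0, as on the negative half-line.\<close>
    then have "K_dist \<alpha> \<beta> \<theta> (x - e) = K_dist \<alpha> \<beta> \<theta> 0"
      using assms by (simp add: K_dist_def powr_powr)
    also have "\<dots> < K_dist \<alpha> \<beta> \<theta> (x + e)"
      using that x assms by (intro K_dist_strict_mono) auto
    finally show ?thesis .
  qed
  then show "x \<in> supp (K_dist \<alpha> \<beta> \<theta>)"
    by (simp add: supp_def)
qed

text \<open>By strict monotonicity on the support the candidates form a closed half-line;
  \<open>p = 0\<close> gives 0 because only points of the support compete. Levels from 1 on are not
  attained, and the infimum of the empty set is \<open>\<infinity>\<close>.\<close>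

lemma quantile_K_dist:
  assumes "0 \<le> \<alpha>" "0 < \<beta>" "0 < \<theta>" "0 \<le> p"
  shows "quantile (K_dist \<alpha> \<beta> \<theta>) p =
    (if p < 1 then ereal (power_odds \<alpha> \<beta> \<theta> (p / (1 - p))) else \<infinity>)"
proof (cases "p < 1")
  case True
  let ?q = "power_odds \<alpha> \<beta> \<theta> (p / (1 - p))"
  have "0 \<le> ?q" using assms True by (intro power_odds_nonneg) auto
  then have "{x \<in> supp (K_dist \<alpha> \<beta> \<theta>). p \<le> K_dist \<alpha> \<beta> \<theta> x} = {?q..}"
    using assms True K_dist_le_iff[of \<alpha> \<beta> \<theta> ?q] K_dist_power_odds[of \<alpha> \<beta> \<theta> p]
    by (auto simp: supp_K_dist)
  moreover have "Inf (ereal ` {?q..}) = ereal ?q"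
    by (intro antisym Inf_lower Inf_greatest) auto
  ultimately show ?thesis
    using True by (simp add: quantile_def)
next
  case False
  then have empty: "{x \<in> supp (K_dist \<alpha> \<beta> \<theta>). p \<le> K_dist \<alpha> \<beta> \<theta> x} = {}"
    using less_le_trans[OF K_dist_less_1[OF assms(1-3)], of p] by (auto simp: not_le not_less)
  show ?thesis
    unfolding quantile_def empty using False by (simp add: top_ereal_def)
qed

section \<open>The odds equation of \<open>G\<close> in real terms\<close>

lemma distribution_function_bounds:
  assumes "distribution_function H"
  shows "0 \<le> H x" "H x \<le> 1"
proof -
  obtain M where M: "real_distribution M" "H = cdf M"
    using assms by (auto simp: distribution_function_def)
  interpret real_distribution M by fact
  show "0 \<le> H x" "H x \<le> 1"
    by (auto simp: M(2) cdf_nonneg cdf_bounded_prob)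
qed

text \<open>If \<open>F x = 1\<close>, the right side of the equation is infinite, which forces
  \<open>H x = 1\<close>. If \<open>F x < 1\<close>, every term is finite and the equation can be
  read over the reals.\<close>

lemma odds_eq_power_odds:
  assumes H: "0 \<le> H x" "H x \<le> 1" and F: "0 \<le> F x" "F x \<le> 1"
    and params: "0 \<le> a" "0 < b" "0 < s"
    and eq: "odds H x = ennreal b * (epowr (ennreal a + odds F x) s - epowr (ennreal a) s)"
  shows "H x = 1 \<longleftrightarrow> F x = 1"
    and "F x < 1 \<Longrightarrow> H x / (1 - H x) = power_odds a b s (F x / (1 - F x))"
proof -
  have 1: "H x = 1" if "F x = 1"
  proof (rule ccontr)
    assume "H x \<noteq> 1"
    moreover have "odds H x = \<top>"
      using eq that params by (simp add: odds_def epowr_def ennreal_mult_top)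
    ultimately show False by (simp add: odds_def)
  qed
  have 2: "H x \<noteq> 1 \<and> H x / (1 - H x) = power_odds a b s (F x / (1 - F x))" if "F x < 1"
  proof -
    let ?l = "F x / (1 - F x)"
    have l: "0 \<le> ?l" using F that by simp
    have "odds H x = ennreal b * (ennreal ((a + ?l) powr s) - ennreal (a powr s))"
      using eq that params l by (simp add: odds_def epowr_ennreal ennreal_plus[symmetric] del: ennreal_plus)
    also have "\<dots> = ennreal (power_odds a b s ?l)"
      using params by (simp add: power_odds_def ennreal_minus ennreal_mult'[symmetric])
    finally have o: "odds H x = ennreal (power_odds a b s ?l)" .
    then have "H x \<noteq> 1" by (auto simp: odds_def)
    moreover have "H x / (1 - H x) = power_odds a b s ?l"
      using o \<open>H x \<noteq> 1\<close> H power_odds_nonneg[OF params l] by (simp add: odds_def)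
    ultimately show ?thesis ..
  qed
  show "H x = 1 \<longleftrightarrow> F x = 1" using 1 2 F by force
  show "H x / (1 - H x) = power_odds a b s (F x / (1 - F x))" if "F x < 1"
    using 2 that by simp
qed

lemma supp_cong:
  assumes "\<And>x y. H x < H y \<longleftrightarrow> F x < F y"
  shows "supp H = supp F"
  using assms by (simp add: supp_def)

theorem theorem5p15:
  fixes F G :: "real \<Rightarrow> real" and f :: "real \<Rightarrow> ennreal"
    and \<alpha> \<beta> \<theta> \<alpha>\<^sub>1 \<beta>\<^sub>1 \<theta>\<^sub>1 :: real
  assumes density: "has_density F f"
    and support: "is_interval (supp F)" "supp F \<subseteq> {0..}" "0 \<in> supp F"
    and F0: "F 0 = 0"
    and f0: "(f \<longlongrightarrow> f 0) (at_right 0)"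
    and params: "\<alpha> \<ge> 0" "\<beta> > 0" "\<theta> > 0"
    and params1: "\<alpha>\<^sub>1 \<ge> 0" "\<beta>\<^sub>1 > 0" "\<theta>\<^sub>1 > 0"
    and G: "distribution_function G"
      "\<forall>x. odds G x =
             ennreal \<beta> * (epowr (ennreal \<alpha> + odds F x) \<theta> - epowr (ennreal \<alpha>) \<theta>)"
  shows "(increasing_odds_rate F f \<and> \<theta> \<ge> 1 \<and> \<theta>\<^sub>1 \<ge> 1 \<and>
          ennreal (\<beta> * \<beta>\<^sub>1 * \<theta> * \<theta>\<^sub>1) * f 0 *
            epowr (ennreal \<alpha>) (\<theta> - 1) * epowr (ennreal \<alpha>\<^sub>1) (\<theta>\<^sub>1 - 1) \<ge> 1
          \<longrightarrow> G \<le>\<^sub>d\<^sub>i\<^sub>s\<^sub>p K_dist \<alpha>\<^sub>1 \<beta>\<^sub>1 \<theta>\<^sub>1)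
       \<and> (decreasing_odds_rate F f \<and> \<theta> \<le> 1 \<and> \<theta>\<^sub>1 \<le> 1 \<and>
          ennreal (\<beta> * \<beta>\<^sub>1 * \<theta> * \<theta>\<^sub>1) * f 0 *
            epowr (ennreal \<alpha>) (\<theta> - 1) * epowr (ennreal \<alpha>\<^sub>1) (\<theta>\<^sub>1 - 1) \<le> 1
          \<longrightarrow> K_dist \<alpha>\<^sub>1 \<beta>\<^sub>1 \<theta>\<^sub>1 \<le>\<^sub>d\<^sub>i\<^sub>s\<^sub>p G)"
proof -
  \<comment> \<open>Where \<open>F x < 1\<close>, these are the odds of \<open>F\<close>, the odds
    of \<open>G\<close> and the quantile of \<open>K_dist\<close> at level \<open>G x\<close>. Where
    \<open>F x = 1\<close>, division by zero makes all three 0, hence the side conditions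
    \<open>F y < 1\<close> below.\<close>
  define L where "L x = F x / (1 - F x)" for x
  define W where "W x = power_odds \<alpha> \<beta> \<theta> (L x)" for x
  define h where "h x = power_odds \<alpha>\<^sub>1 \<beta>\<^sub>1 \<theta>\<^sub>1 (W x)" for x
  let ?e = "epowr (ennreal \<alpha>) (\<theta> - 1)" and ?e1 = "epowr (ennreal \<alpha>\<^sub>1) (\<theta>\<^sub>1 - 1)"
  let ?A = "ennreal (\<beta> * \<beta>\<^sub>1 * \<theta> * \<theta>\<^sub>1) * f 0 * ?e * ?e1"
  note Fb = has_density_bounds[OF density]
  note Gb = distribution_function_bounds[OF G(1)]
  have G1: "G x = 1 \<longleftrightarrow> F x = 1" and odds_G: "F x < 1 \<Longrightarrow> G x / (1 - G x) = W x" for x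
    using odds_eq_power_odds[of G x F \<alpha> \<beta> \<theta>] Gb Fb params G(2) by (auto simp: W_def L_def)
  have G_less1: "G x < 1 \<longleftrightarrow> F x < 1" for x
    using G1[of x] Gb(2)[of x] Fb(3)[of x] by auto
  have L_nonneg: "0 \<le> L x" for x
    using Fb(2,3)[of x] by (simp add: L_def)
  have L_mono: "L x \<le> L y" if "x \<le> y" "F y < 1" for x y
    using monoD[OF Fb(1) that(1)] that(2) by (simp add: L_def odds_le_iff)
  have W_nonneg: "0 \<le> W x" for x
    using params L_nonneg by (simp add: W_def power_odds_nonneg)
  have W_mono: "W x \<le> W y" if "x \<le> y" "F y < 1" for x y
    using L_mono[OF that] L_nonneg[of x] params by (simp add: W_def power_odds_mono)
  have G_le_iff: "G x \<le> G y \<longleftrightarrow> F x \<le> F y" for x y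
  proof (cases "F x < 1 \<and> F y < 1")
    case True
    then have "G x \<le> G y \<longleftrightarrow> W x \<le> W y"
      using odds_le_iff[of "G x" "G y"] by (simp add: G_less1 odds_G)
    also have "\<dots> \<longleftrightarrow> L x \<le> L y"
      using params L_nonneg by (simp add: W_def power_odds_le_iff)
    also have "\<dots> \<longleftrightarrow> F x \<le> F y"
      using True by (simp add: L_def odds_le_iff)
    finally show ?thesis .
  next
    case False
    then show ?thesis
      using G1[of x] G1[of y] Gb(2)[of x] Gb(2)[of y] Fb(3)[of x] Fb(3)[of y] by auto
  qed
  have supp_G: "supp G = supp F"
    by (rule supp_cong) (use G_le_iff in \<open>metis not_le\<close>)
  have between: "t \<in> supp F" if "x \<in> supp F" "y \<in> supp F" "x \<le> t" "t \<le> y" for x y t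
    using mem_is_interval_1_I[OF support(1) that] .
  \<comment> \<open>Identifies \<open>f 0\<close> with the rate at the least point of the support,
    an extreme value of a monotone rate.\<close>
  have rate_0: "odds_rate F f 0 = f 0"
    using F0 by (simp add: odds_rate_def divide_ennreal_def)
  \<comment> \<open>Regroups the constant in the order in which the estimates apply: odds of
    \<open>F\<close> innermost, then \<open>W\<close>, then \<open>h\<close>.\<close>
  have factor: "?A * ennreal d = ennreal (\<beta>\<^sub>1 * \<theta>\<^sub>1) * ?e1 * (ennreal (\<beta> * \<theta>) * ?e * (f 0 * ennreal d))" for d
  proof -
    have "ennreal (\<beta> * \<beta>\<^sub>1 * \<theta> * \<theta>\<^sub>1) = ennreal (\<beta>\<^sub>1 * \<theta>\<^sub>1) * ennreal (\<beta> * \<theta>)"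
      using params params1 by (simp add: mult_ac flip: ennreal_mult)
    then show ?thesis by (simp only: mult_ac)
  qed

  have lower: "y - x \<le> h y - h x"
    if inc: "increasing_odds_rate F f" "\<theta> \<ge> 1" "\<theta>\<^sub>1 \<ge> 1" "?A \<ge> 1"
      and xy: "x \<in> supp F" "y \<in> supp F" "x \<le> y" "F y < 1" for x y
  proof -
    have "f 0 \<le> odds_rate F f t" if "x < t" "t \<le> y" for t
    proof -
      have "t \<in> supp F" using between[OF xy(1,2)] that by simp
      moreover have "0 \<le> t" using support(2) \<open>t \<in> supp F\<close> by auto
      ultimately show ?thesis
        using inc(1) support(3) rate_0 by (auto simp: increasing_odds_rate_def monotone_on_def)
    qed
    then have L: "f 0 * ennreal (y - x) \<le> ennreal (L y - L x)"
      unfolding L_def by (intro has_density_odds_lower[OF density xy(3,4)])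
    have "ennreal (y - x) \<le> ?A * ennreal (y - x)"
      using mult_right_mono[OF inc(4), of "ennreal (y - x)"] by simp
    also have "\<dots> \<le> ennreal (\<beta>\<^sub>1 * \<theta>\<^sub>1) * ?e1 * (ennreal (\<beta> * \<theta>) * ?e * ennreal (L y - L x))"
      unfolding factor using L by (intro mult_left_mono) auto
    also have "\<dots> \<le> ennreal (\<beta>\<^sub>1 * \<theta>\<^sub>1) * ?e1 * ennreal (W y - W x)"
      unfolding W_def using inc params L_nonneg L_mono[OF xy(3,4)]
      by (intro mult_left_mono power_odds_diff_lower) auto
    also have "\<dots> \<le> ennreal (h y - h x)"
      unfolding h_def using inc params1 W_nonneg W_mono[OF xy(3,4)]
      by (intro power_odds_diff_lower) auto
    \<comment> \<open>Since \<open>ennreal\<close> truncates at 0, the comparison could also hold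
      with both differences nonpositive; then \<open>x = y\<close> and both are 0.\<close>
    finally show ?thesis
      using xy by (subst (asm) ennreal_le_iff2) auto
  qed

  have upper: "h y - h x \<le> y - x"
    if dec: "decreasing_odds_rate F f" "\<theta> \<le> 1" "\<theta>\<^sub>1 \<le> 1" "?A \<le> 1"
      and xy: "x \<in> supp F" "y \<in> supp F" "x \<le> y" "F y < 1" for x y
  proof -
    have "odds_rate F f t \<le> f 0" if "x < t" "t \<le> y" for t
    proof -
      have "t \<in> supp F" using between[OF xy(1,2)] that by simp
      moreover have "0 \<le> t" using support(2) \<open>t \<in> supp F\<close> by auto
      ultimately show ?thesis
        using dec(1) support(3) rate_0 by (auto simp: decreasing_odds_rate_def monotone_on_def)
    qed
    then have L: "ennreal (L y - L x) \<le> f 0 * ennreal (y - x)"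
      unfolding L_def by (intro has_density_odds_upper[OF density xy(3,4)])
    have "ennreal (h y - h x) \<le> ennreal (\<beta>\<^sub>1 * \<theta>\<^sub>1) * ?e1 * ennreal (W y - W x)"
      unfolding h_def using dec params1 W_nonneg W_mono[OF xy(3,4)]
      by (intro power_odds_diff_upper) auto
    also have "\<dots> \<le> ennreal (\<beta>\<^sub>1 * \<theta>\<^sub>1) * ?e1 * (ennreal (\<beta> * \<theta>) * ?e * ennreal (L y - L x))"
      unfolding W_def using dec params L_nonneg L_mono[OF xy(3,4)]
      by (intro mult_left_mono power_odds_diff_upper) auto
    also have "\<dots> \<le> ?A * ennreal (y - x)"
      unfolding factor using L by (intro mult_left_mono) auto
    also have "\<dots> \<le> ennreal (y - x)"
      using mult_right_mono[OF dec(4), of "ennreal (y - x)"] by simp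
    finally show ?thesis
      using xy by (subst (asm) ennreal_le_iff) auto
  qed

  have "G \<le>\<^sub>d\<^sub>i\<^sub>s\<^sub>p K_dist \<alpha>\<^sub>1 \<beta>\<^sub>1 \<theta>\<^sub>1"
    if inc: "increasing_odds_rate F f" "\<theta> \<ge> 1" "\<theta>\<^sub>1 \<ge> 1" "?A \<ge> 1"
    unfolding disp_le_def supp_G
  proof (rule monotone_onI)
    fix x y assume xy: "x \<in> supp F" "y \<in> supp F" "x \<le> y"
    show "quantile (K_dist \<alpha>\<^sub>1 \<beta>\<^sub>1 \<theta>\<^sub>1) (G x) - ereal x
        \<le> quantile (K_dist \<alpha>\<^sub>1 \<beta>\<^sub>1 \<theta>\<^sub>1) (G y) - ereal y"
    proof (cases "F y < 1")
      case True
      then have "F x < 1" using monoD[OF Fb(1) xy(3)] by simp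
      with True show ?thesis
        using lower[OF inc xy] params1 Gb by (simp add: quantile_K_dist G_less1 odds_G h_def)
    next
      \<comment> \<open>Now \<open>G y = 1\<close>, a level that \<open>K_dist\<close> does not
        attain, so the right side is \<open>\<infinity>\<close>.\<close>
      case False
      then show ?thesis
        using params1 Gb by (simp add: quantile_K_dist G_less1)
    qed
  qed
  moreover have "K_dist \<alpha>\<^sub>1 \<beta>\<^sub>1 \<theta>\<^sub>1 \<le>\<^sub>d\<^sub>i\<^sub>s\<^sub>p G"
    if dec: "decreasing_odds_rate F f" "\<theta> \<le> 1" "\<theta>\<^sub>1 \<le> 1" "?A \<le> 1"
    unfolding disp_le_def supp_K_dist[OF params1]
  proof (rule monotone_onI)
    let ?K = "K_dist \<alpha>\<^sub>1 \<beta>\<^sub>1 \<theta>\<^sub>1"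
    fix p q :: real assume pq: "p \<in> {0..}" "q \<in> {0..}" "p \<le> q"
    \<comment> \<open>Exponents at most 0 never give the power 0, so an infinite \<open>f 0\<close>
      would make the constant infinite, contrary to the bound by 1.\<close>
    have "?e \<noteq> 0" "?e1 \<noteq> 0"
      using dec params params1 by (auto simp: epowr_def)
    then have "f 0 \<noteq> \<top>"
      using dec(4) params params1
      by (auto simp: ennreal_mult_top ennreal_top_mult ennreal_mult_eq_top_iff top_unique)
    \<comment> \<open>The rate is at most \<open>f 0\<close>, which is finite, whereas it is
      \<open>\<top>\<close> by definition wherever \<open>F = 1\<close>.\<close>
    have F_less1: "F y < 1" if "y \<in> supp F" for y
    proof -
      have "0 \<le> y" using support(2) that by auto
      then have "odds_rate F f y \<le> f 0"
        using dec(1) support(3) rate_0 that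
        by (auto simp: decreasing_odds_rate_def monotone_on_def)
      then show ?thesis
        using \<open>f 0 \<noteq> \<top>\<close> Fb(3)[of y] by (auto simp: odds_rate_def top_unique split: if_splits)
    qed
    \<comment> \<open>Describes the candidates for the quantile of \<open>G\<close> at level
      \<open>?K x\<close> through \<open>h\<close>, since \<open>?K\<close> maps \<open>h y\<close>
      to \<open>G y\<close>.\<close>
    have K_le_G: "?K x \<le> G y \<longleftrightarrow> x \<le> h y" if "0 \<le> x" "y \<in> supp F" for x y
    proof -
      have "0 \<le> h y" using params1 W_nonneg by (simp add: h_def power_odds_nonneg)
      moreover have "?K (h y) = G y"
        using K_dist_power_odds[OF params1, of "G y"] Gb F_less1[OF that(2)]
        by (simp add: G_less1 odds_G h_def)
      ultimately show ?thesis
        using K_dist_le_iff[OF params1 that(1)] by metis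
    qed
    \<comment> \<open>Shifting a candidate for \<open>q\<close> left by \<open>q - p\<close> gives one for \<open>p\<close>; no inverse of \<open>G\<close> is needed.\<close>
    have "quantile G (?K p) \<le> ereal (y - (q - p))" if y: "y \<in> supp F" "?K q \<le> G y" for y
    proof -
      define z where "z = y - (q - p)"
      \<comment> \<open>From \<open>q \<le> h y \<le> y\<close> follows
        \<open>z \<ge> p \<ge> 0\<close>, so the shift stays inside the support.\<close>
      have "q \<le> h y" using K_le_G[of q y] y pq by simp
      moreover have "0 \<le> y" using support(2) y by auto
      moreover have "h y - h 0 \<le> y"
        using upper[OF dec support(3) y(1) \<open>0 \<le> y\<close>] F_less1[OF y(1)] by simp
      moreover have "h 0 = 0" by (simp add: h_def W_def L_def F0)
      ultimately have z: "0 \<le> z" "z \<le> y" using pq by (auto simp: z_def)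
      then have "z \<in> supp F" using between[OF support(3) y(1)] by simp
      moreover have "h y - h z \<le> y - z"
        using upper[OF dec \<open>z \<in> supp F\<close> y(1) z(2)] F_less1[OF y(1)] by simp
      then have "p \<le> h z" using \<open>q \<le> h y\<close> by (simp add: z_def)
      then have "?K p \<le> G z" using K_le_G[of p z] pq \<open>z \<in> supp F\<close> by simp
      ultimately show ?thesis
        unfolding quantile_def supp_G z_def[symmetric] by (intro Inf_lower) auto
    qed
    then have "quantile G (?K p) + ereal (q - p) \<le> ereal y" if "y \<in> supp F" "?K q \<le> G y" for y
      using that by (cases "quantile G (?K p)") force+
    then have "quantile G (?K p) + ereal (q - p) \<le> quantile G (?K q)"
      unfolding quantile_def[of G "?K q"] supp_G by (intro Inf_greatest) auto
    then show "quantile G (?K p) - ereal p \<le> quantile G (?K q) - ereal q"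
      by (cases "quantile G (?K p)"; cases "quantile G (?K q)") auto
  qed
  ultimately show ?thesis by blast
qed

end
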